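(* Let $\tau=\gamma_1\cdots\gamma_r\in\mathfrak{S}_n\setminus\{id\}$ be written in standard cycle form. Then $x_{\gamma_1\cdots\gamma_r}$ is the concatenation of $x_{\gamma_1},\dots,x_{\gamma_r}$: $$x_{\gamma_1\cdots\gamma_r}=x_{\gamma_1}\cdots x_{\gamma_r}.$$
   Context: Let $[n]=\{1,\dots,n\}$ and $\mathfrak{S}_n$ the group of permutations of $[n]$. An injective word over $[n]$ is a finite sequence $\omega=\omega_1\cdots\omega_k$ of distinct elements of $[n]$ ($0\le k\le n$); its content is $c(\omega)=\{\omega_1,\dots,\omega_k\}$. $\Gamma_n$ is the set of all injective words, $\Gamma(A)=\{\omega\in\Gamma_n:c(\omega)=A\}$, and $L(\Gamma_n)$ is the real vector space of functions on $\Gamma_n$, a word being identified with its Dirac function. A cycle $(a_1\dots a_m)$, with $m\ge2$ distinct letters, maps $a_i\mapsto a_{i+1}$, $a_m\mapsto a_1$ and fixes the other elements of $[n]$. Chains $x_\tau$. The concatenation product $(x,y)\mapsto xy$ on $L(\Gamma_n)$ is the bilinear map sending Dirac functions $(\pi,\pi')$ to the concatenated word $\pi\pi'$ if $c(\pi)\cap c(\pi')=\emptyset$ and to $0$ otherwise; $x\diamond y:=xy-yx$. The standard cycle form of a permutation $\tau\neq id$ of $[n]$ is its expression as a product of disjoint cycles of length $\ge2$, each cycle being written with its minimum element leftmost, and the cycles being arranged from left to right by increasing minimum element. For $\tau\ne id$, the chain $x_\tau\in L(\Gamma(\mathrm{supp}(\tau)))$, $\mathrm{supp}(\tau)=\{i:\tau(i)\neq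 i\}$, is the output of the following procedure. Write $\tau$ in standard cycle form and insert a symbol $\star$ between each two consecutive letters in each cycle. As long as a symbol $\star$ remains anywhere in the string, take the $\star$ whose right-hand neighbor (the letter immediately to its right, ignoring parentheses) is largest; if it appears as $Q\star R$ between quantities $Q$ and $R$ (each a single letter or an already formed parenthesized expression), replace $Q\star R$ by $(Q\diamond R)$. When no $\star$ remains, the string, read as the concatenation product of the expressions coming from the successive cycles (a letter being the corresponding one-letter word), is $x_\tau$. For example $x_{(134)(25)}=(1\diamond(3\diamond4))(2\diamond5)$. *)

theory Defs
  imports
    Complex_Main
    "HOL-Combinatorics.Combinatorics"
    "HOL-Library.While_Combinator"
begin

definition injective_words :: "nat \<Rightarrow> nat list set"  (\<open>\<Gamma>\<close>)
  where "\<Gamma> n = {w. distinct w \<and> set w \<subseteq> {1..n}}"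

text \<open>Elements of \<open>L(\<Gamma> n)\<close>, the real functions on the finite set \<open>\<Gamma> n\<close>, are represented as total
  functions \<open>nat list \<Rightarrow> real\<close> vanishing outside \<open>\<Gamma> n\<close>.\<close>

type_synonym word_fun = "nat list \<Rightarrow> real"

definition dirac :: "nat list \<Rightarrow> word_fun"
  where "dirac w = (\<lambda>v. if v = w then 1 else 0)"

text \<open>The bilinear extension of the product of two Dirac functions.\<close>

definition concat_prod :: "nat \<Rightarrow> word_fun \<Rightarrow> word_fun \<Rightarrow> word_fun"
  where "concat_prod n x y =
    (\<lambda>w. \<Sum>u\<in>\<Gamma> n. \<Sum>v\<in>\<Gamma> n. x u * y v * (if set u \<inter> set v = {} then dirac (u @ v) w else 0))"

definition diamond :: "nat \<Rightarrow> word_fun \<Rightarrow> word_fun \<Rightarrow> word_fun"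
  where "diamond n x y = (\<lambda>w. concat_prod n x y w - concat_prod n y x w)"

text \<open>The empty product is the empty word, which is the unit of \<^const>\<open>concat_prod\<close> on \<open>L(\<Gamma> n)\<close>.\<close>

definition concat_prod_list :: "nat \<Rightarrow> word_fun list \<Rightarrow> word_fun"
  where "concat_prod_list n xs = foldr (concat_prod n) xs (dirac [])"

text \<open>Permutations are functions \<open>nat \<Rightarrow> nat\<close>; a cycle is the list of its letters.\<close>

definition is_standard_cycle_form :: "(nat \<Rightarrow> nat) \<Rightarrow> nat list list \<Rightarrow> bool"
  where "is_standard_cycle_form \<tau> cs \<longleftrightarrow>
    \<tau> = foldr (\<circ>) (map cycle_of_list cs) id \<and>
    (\<forall>c\<in>set cs. length c \<ge> 2) \<and>
    distinct (concat cs) \<and>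
    (\<forall>c\<in>set cs. hd c = Min (set c)) \<and>
    sorted_wrt (<) (map hd cs)"

definition standard_cycle_form :: "(nat \<Rightarrow> nat) \<Rightarrow> nat list list"
  where "standard_cycle_form \<tau> = (THE cs. is_standard_cycle_form \<tau> cs)"

lemma foldr_cycles_apply:
  assumes "distinct (concat cs)" "c \<in> set cs" "a \<in> set c"
  shows "foldr (\<circ>) (map cycle_of_list cs) id a = cycle_of_list c a"
  using assms
proof (induction cs)
  case (Cons d cs)
  have out: "foldr (\<circ>) (map cycle_of_list es) id a = a" if "\<forall>e\<in>set es. a \<notin> set e" for es
    using that by (induction es) (auto simp: id_outside_supp)
  have step: "foldr (\<circ>) (map cycle_of_list (d # cs)) id a =
      cycle_of_list d (foldr (\<circ>) (map cycle_of_list cs) id a)" by simp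
  show ?case
  proof (cases "a \<in> set d")
    case True
    with Cons.prems have "c = d" "\<forall>e\<in>set cs. a \<notin> set e" by (auto split: if_splits)
    then show ?thesis unfolding step using out[of cs] by metis
  next
    case False
    with Cons.prems have c: "c \<in> set cs" by auto
    have "cycle_of_list c a \<in> set c"
      using cycle_permutes[of c] Cons.prems by (simp add: permutes_in_image)
    moreover have "set c \<inter> set d = {}" using Cons.prems c by auto
    ultimately have "cycle_of_list c a \<notin> set d" by auto
    then show ?thesis using Cons.IH[OF _ c] Cons.prems by (auto simp: id_outside_supp split: if_splits)
  qed
qed simp

lemma foldr_cycles_outside:
  assumes "\<forall>c\<in>set cs. a \<notin> set c"
  shows "foldr (\<circ>) (map cycle_of_list cs) id a = a"
  using assms by (induction cs) (auto simp: id_outside_supp)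

lemma standard_cycle_funpow:
  assumes "is_standard_cycle_form \<tau> cs" "c \<in> set cs"
  shows "(\<tau> ^^ k) (hd c) = c ! (k mod length c)"
proof -
  have d: "distinct (concat cs)" and t: "\<tau> = foldr (\<circ>) (map cycle_of_list cs) id"
    and len: "length c \<ge> 2"
    using assms unfolding is_standard_cycle_form_def by auto
  have ne: "c \<noteq> []" using len by auto
  have dc: "distinct c" using d assms(2) by (simp add: distinct_concat_iff)
  have "(\<tau> ^^ k) (hd c) = (cycle_of_list c ^^ k) (hd c) \<and> (cycle_of_list c ^^ k) (hd c) \<in> set c"
  proof (induction k)
    case (Suc k)
    then show ?case using foldr_cycles_apply[OF d assms(2)] cycle_permutes[of c]
      by (simp add: t permutes_in_image)
  qed (simp add: ne)
  moreover have "(cycle_of_list c ^^ k) (hd c) = hd (map (cycle_of_list c ^^ k) c)"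
    using ne by (simp add: list.map_sel)
  moreover have "\<dots> = c ! (k mod length c)"
    using cyclic_rotation[OF dc] ne by (simp add: hd_rotate_conv_nth)
  ultimately show ?thesis by simp
qed

lemma standard_cycle_eq:
  assumes "is_standard_cycle_form \<tau> cs" "c \<in> set cs"
  shows "c = support \<tau> (hd c)"
proof -
  have len: "length c \<ge> 2" and dc: "distinct c"
    using assms unfolding is_standard_cycle_form_def by (auto simp: distinct_concat_iff)
  note p = standard_cycle_funpow[OF assms]
  have h: "hd c = c ! 0" using len by (intro hd_conv_nth) auto
  have "least_power \<tau> (hd c) = length c"
    unfolding least_power_def
  proof (rule Least_equality)
    show "(\<tau> ^^ length c) (hd c) = hd c \<and> length c > 0" using p[of "length c"] len h by (auto simp: Suc_le_eq)
  next
    fix k assume k: "(\<tau> ^^ k) (hd c) = hd c \<and> k > 0"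
    show "length c \<le> k"
    proof (rule ccontr)
      assume "\<not> length c \<le> k"
      then show False using k p[of k] h nth_eq_iff_index_eq[OF dc, of k 0] by (metis len gr_implies_not0 length_greater_0_conv list.size(3) mod_less not_less not_numeral_le_zero)
    qed
  qed
  then show ?thesis using p by (auto intro!: nth_equalityI)
qed

lemma standard_heads:
  assumes "is_standard_cycle_form \<tau> cs"
  shows "set (map hd cs) = {i. \<tau> i \<noteq> i \<and> (\<forall>k. i \<le> (\<tau> ^^ k) i)}"
proof -
  have d: "distinct (concat cs)" and t: "\<tau> = foldr (\<circ>) (map cycle_of_list cs) id"
    and len: "\<And>c. c \<in> set cs \<Longrightarrow> length c \<ge> 2"
    and mn: "\<And>c. c \<in> set cs \<Longrightarrow> hd c = Min (set c)"
    using assms unfolding is_standard_cycle_form_def by auto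
  show ?thesis
  proof (intro equalityI subsetI)
    fix i assume "i \<in> set (map hd cs)"
    then obtain c where c: "c \<in> set cs" "i = hd c" by auto
    note p = standard_cycle_funpow[OF assms c(1), folded c(2)]
    have dc: "distinct c" using d c(1) by (simp add: distinct_concat_iff)
    have h: "i = c ! 0" using len[OF c(1)] c(2) by (auto intro: hd_conv_nth)
    have "c ! 1 \<noteq> c ! 0" using dc len[OF c(1)] by (subst nth_eq_iff_index_eq) auto
    then have "\<tau> i \<noteq> i" using p[of 1] h len[OF c(1)] by simp
    moreover have "i \<le> (\<tau> ^^ k) i" for k
    proof -
      have "(\<tau> ^^ k) i \<in> set c" unfolding p using len[OF c(1)]
        by (intro nth_mem mod_less_divisor) linarith
      then show ?thesis using mn[OF c(1)] c(2) by (metis Min_le List.finite_set)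
    qed
    ultimately show "i \<in> {i. \<tau> i \<noteq> i \<and> (\<forall>k. i \<le> (\<tau> ^^ k) i)}" by simp
  next
    fix i assume i: "i \<in> {i. \<tau> i \<noteq> i \<and> (\<forall>k. i \<le> (\<tau> ^^ k) i)}"
    then obtain c where c: "c \<in> set cs" "i \<in> set c"
      using foldr_cycles_outside[of cs i] t by auto
    have dc: "distinct c" using d c(1) by (simp add: distinct_concat_iff)
    obtain j where j: "j < length c" "c ! j = i" using c(2) by (auto simp: in_set_conv_nth)
    note p = standard_cycle_funpow[OF assms c(1)]
    have ij: "i = (\<tau> ^^ j) (hd c)" using p[of j] j by simp
    have "(\<tau> ^^ (length c - j)) i = (\<tau> ^^ (length c - j + j)) (hd c)"
      unfolding ij funpow_add by simp
    also have "\<dots> = hd c" using p[of "length c"] j len[OF c(1)]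
      by (cases c) auto
    finally have "i \<le> hd c" using i by (metis (mono_tags, lifting) mem_Collect_eq)
    moreover have "hd c \<le> i" using mn[OF c(1)] c(2) by simp
    ultimately show "i \<in> set (map hd cs)" using c(1) by auto
  qed
qed

lemma is_standard_cycle_form_unique:
  assumes "is_standard_cycle_form \<tau> cs" "is_standard_cycle_form \<tau> ds"
  shows "cs = ds"
proof -
  have "map hd cs = map hd ds"
    using standard_heads[OF assms(1)] standard_heads[OF assms(2)] assms
    by (intro strict_sorted_equal) (auto simp: is_standard_cycle_form_def)
  moreover have "cs = map (support \<tau>) (map hd cs)" "ds = map (support \<tau>) (map hd ds)"
    using standard_cycle_eq[OF assms(1)] standard_cycle_eq[OF assms(2)] 
    by (auto intro!: map_idI[symmetric] simp del: map_map simp: map_map comp_def)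
  ultimately show ?thesis by simp
qed

lemma standard_cycle_form_eqI: "is_standard_cycle_form \<tau> cs \<Longrightarrow> standard_cycle_form \<tau> = cs"
  unfolding standard_cycle_form_def using is_standard_cycle_form_unique by blast

text \<open>The strings handled by the procedure. The expressions keep their bracketing, since the procedure
  has to look at their leftmost letter; the parentheses around the cycles play no role and are
  dropped, two neighbouring cycles being recognizable by the absence of a star between them.\<close>

datatype expr = Letter nat | Diamond expr expr

datatype symbol = Star | Quantity (quantity: expr)

fun leftmost_letter :: "expr \<Rightarrow> nat" where
  "leftmost_letter (Letter a) = a"
| "leftmost_letter (Diamond Q R) = leftmost_letter Q"

fun starred_cycle :: "nat list \<Rightarrow> symbol list" where
  "starred_cycle [] = []"
| "starred_cycle [a] = [Quantity (Letter a)]"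
| "starred_cycle (a # b # c) = Quantity (Letter a) # Star # starred_cycle (b # c)"

definition initial_string :: "(nat \<Rightarrow> nat) \<Rightarrow> symbol list"
  where "initial_string \<tau> = concat (map starred_cycle (standard_cycle_form \<tau>))"

text \<open>The right-hand neighbours of all stars.\<close>

fun star_neighbors :: "symbol list \<Rightarrow> nat list" where
  "star_neighbors (Star # Quantity R # s) = leftmost_letter R # star_neighbors s"
| "star_neighbors (_ # s) = star_neighbors s"
| "star_neighbors [] = []"

text \<open>Replace \<open>Q \<star> R\<close> by \<open>(Q \<diamondop> R)\<close> at the star whose right-hand neighbour is \<open>m\<close>.\<close>

fun contract :: "nat \<Rightarrow> symbol list \<Rightarrow> symbol list" where
  "contract m (Quantity Q # Star # Quantity R # s) =
     (if leftmost_letter R = m then Quantity (Diamond Q R) # s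
      else Quantity Q # Star # contract m (Quantity R # s))"
| "contract m (a # s) = a # contract m s"
| "contract m [] = []"

definition final_string :: "(nat \<Rightarrow> nat) \<Rightarrow> symbol list"
  where "final_string \<tau> =
    while (\<lambda>s. Star \<in> set s) (\<lambda>s. contract (Max (set (star_neighbors s))) s) (initial_string \<tau>)"

lemma final_string_example: "final_string (cycle_of_list [1,3,4] \<circ> cycle_of_list [2,5]) =
   [Quantity (Diamond (Letter 1) (Diamond (Letter 3) (Letter 4))), Quantity (Diamond (Letter 2) (Letter 5))]"
proof -
  have "is_standard_cycle_form (cycle_of_list [1,3,4] \<circ> cycle_of_list [2,5]) [[1,3,4],[2,5]]"
    by (simp add: is_standard_cycle_form_def del: cycle_of_list.simps)
  then show ?thesis
    unfolding final_string_def initial_string_def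
    by (simp add: standard_cycle_form_eqI while_unfold del: cycle_of_list.simps)
qed

fun expr_value :: "nat \<Rightarrow> expr \<Rightarrow> word_fun" where
  "expr_value n (Letter a) = dirac [a]"
| "expr_value n (Diamond Q R) = diamond n (expr_value n Q) (expr_value n R)"

definition perm_chain :: "nat \<Rightarrow> (nat \<Rightarrow> nat) \<Rightarrow> word_fun"
  where "perm_chain n \<tau> = concat_prod_list n (map (expr_value n \<circ> quantity) (final_string \<tau>))"

end

theory Submission
  imports Defs
begin

text \<open>
  A star always sits inside one cycle, and the procedure chooses the star to contract by looking only
  at its right-hand neighbor. So if the maximal neighbor of the string of \<open>\<gamma>\<^sub>1 \<cdots> \<gamma>\<^sub>r\<close> lies in the
  string of \<open>\<gamma>\<^sub>i\<close>, it is also the maximal neighbor within that string: each step of the procedure on the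
  whole string is a step of the procedure on one of the cycles and leaves the other cycles alone.
  Running the procedure to the end therefore interleaves the runs for the single cycles, and the result
  is the concatenation of their results (\<open>reduce_append\<close>, \<open>reduce_concat\<close>).

  Each contraction removes one star and one quantity. As a cycle starts with one more quantity than
  stars, its run ends in a single expression \<open>e\<^sub>i\<close> (\<open>reduce_starred_cycle\<close>). The left-hand side of the
  identity is thus the product of the values of \<open>e\<^sub>1, \<dots>, e\<^sub>r\<close>, and the chain of
  \<open>\<gamma>\<^sub>i\<close> is the product with this single factor, that is, the value of \<open>e\<^sub>i\<close> times the empty word.
  The empty word is a right unit only for functions that vanish outside \<open>\<Gamma> n\<close>. This holds
  for the value of \<open>e\<^sub>i\<close> because a cycle has at least two letters and contractions preserve the letters,
  so that \<open>e\<^sub>i\<close> is a \<open>\<diamondop>\<close>-product.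
\<close>

section \<open>Strings in which every star separates two quantities\<close>

text \<open>Concatenations of starred cycles have this property. It guarantees that a star never sits at
  the boundary of two concatenated strings, where it would acquire a new neighbor.\<close>

fun stars_enclosed :: "symbol list \<Rightarrow> bool" where
  "stars_enclosed [] = True"
| "stars_enclosed [Quantity Q] = True"
| "stars_enclosed (Quantity Q # Quantity R # s) = stars_enclosed (Quantity R # s)"
| "stars_enclosed (Quantity Q # Star # Quantity R # s) = stars_enclosed (Quantity R # s)"
| "stars_enclosed _ = False"

lemma stars_enclosed_append:
  "stars_enclosed s \<Longrightarrow> stars_enclosed t \<Longrightarrow> stars_enclosed (s @ t)"
  by (induction s rule: stars_enclosed.induct) (auto elim: stars_enclosed.elims)

lemma star_neighbors_append:
  "stars_enclosed s \<Longrightarrow> star_neighbors (s @ t) = star_neighbors s @ star_neighbors t"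
  by (induction s rule: stars_enclosed.induct) auto

lemma Star_iff_star_neighbors:
  "stars_enclosed s \<Longrightarrow> Star \<in> set s \<longleftrightarrow> star_neighbors s \<noteq> []"
  by (induction s rule: stars_enclosed.induct) auto

text \<open>A contraction at a given letter happens in the first of two concatenated strings if the letter
  is a neighbor of a star there, and passes over the first string otherwise.\<close>

lemma contract_append_left:
  "stars_enclosed s \<Longrightarrow> m \<in> set (star_neighbors s) \<Longrightarrow> contract m (s @ t) = contract m s @ t"
  by (induction s rule: stars_enclosed.induct) auto

lemma contract_append_right:
  "stars_enclosed s \<Longrightarrow> stars_enclosed t \<Longrightarrow> m \<notin> set (star_neighbors s) \<Longrightarrow>
    contract m (s @ t) = s @ contract m t"
  by (induction s rule: stars_enclosed.induct) (auto elim: stars_enclosed.elims)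

text \<open>A contraction at the front of a string merges the first two expressions; what follows them is
  still enclosed, since being enclosed depends only on the kinds of the symbols.\<close>

lemma stars_enclosed_replace_first:
  "stars_enclosed (Quantity R # s) \<Longrightarrow> stars_enclosed (Quantity Q # s)"
  by (cases "Quantity R # s" rule: stars_enclosed.cases) auto

lemma contract_starts_with_quantity:
  "stars_enclosed (Quantity Q # s) \<Longrightarrow> \<exists>Q' s'. contract m (Quantity Q # s) = Quantity Q' # s'"
  by (cases "Quantity Q # s" rule: stars_enclosed.cases) auto

lemma stars_enclosed_contract: "stars_enclosed s \<Longrightarrow> stars_enclosed (contract m s)"
proof (induction s rule: stars_enclosed.induct)
  case (3 Q R s)
  then show ?case using contract_starts_with_quantity[of R s m] by force
next
  case (4 Q R s)
  then show ?case using contract_starts_with_quantity[of R s m] stars_enclosed_replace_first[of R s] by force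
qed auto

text \<open>The measure that makes the procedure terminate, and the count that makes the string of a cycle
  end as a single quantity.\<close>

lemma contract_size:
  assumes "stars_enclosed s" "m \<in> set (star_neighbors s)"
  shows "length s = length (contract m s) + 2"
    and "count_list s Star = count_list (contract m s) Star + 1"
  using assms by (induction s rule: stars_enclosed.induct) auto

section \<open>The procedure on concatenated strings\<close>

abbreviation step :: "symbol list \<Rightarrow> symbol list"
  where "step s \<equiv> contract (Max (set (star_neighbors s))) s"

text \<open>The loop of the procedure, started from an arbitrary string rather than from the initial
  string of a permutation, so that it can be compared on a string and on its parts.\<close>

definition reduce :: "symbol list \<Rightarrow> symbol list"
  where "reduce = while (\<lambda>s. Star \<in> set s) step"

lemma final_string_eq_reduce:
  "is_standard_cycle_form \<tau> cs \<Longrightarrow> final_string \<tau> = reduce (concat (map starred_cycle cs))"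
  by (simp add: final_string_def initial_string_def reduce_def standard_cycle_form_eqI)

lemma reduce_unfold: "reduce s = (if Star \<in> set s then reduce (step s) else s)"
  unfolding reduce_def by (rule while_unfold)

lemma Max_star_neighbors:
  "stars_enclosed s \<Longrightarrow> Star \<in> set s \<Longrightarrow> Max (set (star_neighbors s)) \<in> set (star_neighbors s)"
  by (simp add: Star_iff_star_neighbors)

text \<open>Induction along a run of the procedure, which terminates because each step shortens the string.\<close>

lemma reduce_induct [consumes 1, case_names step]:
  assumes "stars_enclosed s"
    and "\<And>s. \<lbrakk>stars_enclosed s; Star \<in> set s \<Longrightarrow> P (step s)\<rbrakk> \<Longrightarrow> P s"
  shows "P s"
  using assms(1)
proof (induction s rule: length_induct)
  case (1 s)
  show ?case
  proof (rule assms(2))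
    assume "Star \<in> set s"
    then have "length (step s) < length s"
      using contract_size(1) Max_star_neighbors 1 by fastforce
    then show "P (step s)" using 1 stars_enclosed_contract by blast
  qed (use 1 in simp)
qed

lemma Max_Un_cases:
  fixes A B :: "nat set"
  assumes "finite A" "finite B" "A \<union> B \<noteq> {}"
  shows "Max (A \<union> B) \<in> A \<and> Max (A \<union> B) = Max A \<or>
    Max (A \<union> B) \<notin> A \<and> Max (A \<union> B) \<in> B \<and> Max (A \<union> B) = Max B"
proof -
  have "Max (A \<union> B) \<in> A \<union> B" using assms by (intro Max_in) auto
  moreover have "Max (A \<union> B) = Max A" if "Max (A \<union> B) \<in> A"
    using that assms by (intro Max_eqI[symmetric]) auto
  moreover have "Max (A \<union> B) = Max B" if "Max (A \<union> B) \<in> B"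
    using that assms by (intro Max_eqI[symmetric]) auto
  ultimately show ?thesis by blast
qed

text \<open>The maximal neighbor of the whole string is the maximal neighbor of the part that contains it,
  so a step on the whole string is a step of the procedure on that part. If both parts contain this
  letter as a neighbor, the step takes place in the left one.\<close>

lemma step_append:
  assumes "stars_enclosed s" "stars_enclosed t" "Star \<in> set (s @ t)"
  shows "Star \<in> set s \<and> step (s @ t) = step s @ t \<or> Star \<in> set t \<and> step (s @ t) = s @ step t"
proof -
  let ?A = "set (star_neighbors s)" and ?B = "set (star_neighbors t)"
  have "?A \<union> ?B \<noteq> {}" using assms by (auto simp: Star_iff_star_neighbors)
  from Max_Un_cases[OF _ _ this] show ?thesis
    using assms by (auto simp: star_neighbors_append Star_iff_star_neighbors
        contract_append_left contract_append_right)
qed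

text \<open>By induction along the run on \<open>s @ t\<close>: its first step is a step on one of the parts, and the
  final result for that part is the same before and after the step.\<close>

lemma reduce_append:
  assumes "stars_enclosed s" "stars_enclosed t"
  shows "reduce (s @ t) = reduce s @ reduce t"
proof -
  have "stars_enclosed (s @ t)" using assms by (rule stars_enclosed_append)
  then show ?thesis using assms
  proof (induction "s @ t" arbitrary: s t rule: reduce_induct)
    case step
    show ?case
    proof (cases "Star \<in> set (s @ t)")
      case True
      from step_append[OF step.prems this] show ?thesis
      proof
        assume *: "Star \<in> set s \<and> step (s @ t) = step s @ t"
        then have "reduce (step s @ t) = reduce (step s) @ reduce t"
          using True step by (auto simp: stars_enclosed_contract)
        then show ?thesis
          using * True reduce_unfold[of "s @ t"] reduce_unfold[of s] by simp
      next
        assume *: "Star \<in> set t \<and> step (s @ t) = s @ step t"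
        then have "reduce (s @ step t) = reduce s @ reduce (step t)"
          using True step by (auto simp: stars_enclosed_contract)
        then show ?thesis
          using * True reduce_unfold[of "s @ t"] reduce_unfold[of t] by simp
      qed
    next
      case False
      then show ?thesis by (simp add: reduce_unfold[of s] reduce_unfold[of t] reduce_unfold[of "s @ t"])
    qed
  qed
qed

lemma stars_enclosed_concat: "\<forall>s\<in>set ss. stars_enclosed s \<Longrightarrow> stars_enclosed (concat ss)"
  by (induction ss) (auto simp: stars_enclosed_append)

lemma reduce_concat:
  "\<forall>s\<in>set ss. stars_enclosed s \<Longrightarrow> reduce (concat ss) = concat (map reduce ss)"
  by (induction ss) (auto simp: reduce_append stars_enclosed_concat reduce_unfold[of "[]"])

section \<open>The procedure on a single cycle\<close>

fun expr_letters :: "expr \<Rightarrow> nat list" where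
  "expr_letters (Letter a) = [a]"
| "expr_letters (Diamond Q R) = expr_letters Q @ expr_letters R"

fun symbol_letters :: "symbol \<Rightarrow> nat list" where
  "symbol_letters Star = []"
| "symbol_letters (Quantity Q) = expr_letters Q"

abbreviation string_letters :: "symbol list \<Rightarrow> nat list"
  where "string_letters s \<equiv> concat (map symbol_letters s)"

lemma string_letters_contract: "string_letters (contract m s) = string_letters s"
  by (induction m s rule: contract.induct) auto

text \<open>The third equation expresses that the number of quantities minus the number of stars, which is
  the length minus twice the number of stars, is preserved and that no star is left at the end.\<close>

lemma reduce_invariants:
  assumes "stars_enclosed s"
  shows "Star \<notin> set (reduce s)"
    and "string_letters (reduce s) = string_letters s"
    and "length (reduce s) + 2 * count_list s Star = length s"
proof -
  have "Star \<notin> set (reduce s) \<and> string_letters (reduce s) = string_letters s \<and>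
    length (reduce s) + 2 * count_list s Star = length s"
    using assms
  proof (induction s rule: reduce_induct)
    case (step s)
    show ?case
    proof (cases "Star \<in> set s")
      case True
      note contract_size[OF step.hyps Max_star_neighbors[OF step.hyps True]]
      with step.IH[OF True] True show ?thesis
        by (simp add: reduce_unfold[of s] string_letters_contract)
    next
      case False
      then show ?thesis by (simp add: reduce_unfold[of s] count_list_0_iff)
    qed
  qed
  then show "Star \<notin> set (reduce s)" "string_letters (reduce s) = string_letters s"
    "length (reduce s) + 2 * count_list s Star = length s" by auto
qed

lemma starred_cycle_Cons: "\<exists>t. starred_cycle (a # c) = Quantity (Letter a) # t"
  by (cases c) auto

lemma stars_enclosed_starred_cycle: "stars_enclosed (starred_cycle c)"
proof (induction c rule: starred_cycle.induct)
  case (3 a b c)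
  then show ?case using starred_cycle_Cons[of b c] by auto
qed auto

lemma string_letters_starred_cycle: "string_letters (starred_cycle c) = c"
  by (induction c rule: starred_cycle.induct) auto

lemma length_starred_cycle:
  "c \<noteq> [] \<Longrightarrow> length (starred_cycle c) = 2 * count_list (starred_cycle c) Star + 1"
  by (induction c rule: starred_cycle.induct) auto

text \<open>A starred cycle has one more quantity than stars, so one quantity is left at the end. Its
  letters are recorded in order to exclude that it is a single letter.\<close>

lemma reduce_starred_cycle:
  assumes "c \<noteq> []"
  obtains e where "reduce (starred_cycle c) = [Quantity e]" "expr_letters e = c"
proof -
  note inv = reduce_invariants[OF stars_enclosed_starred_cycle[of c]]
  have "length (reduce (starred_cycle c)) = 1"
    using inv(3) length_starred_cycle[OF assms] by linarith
  then obtain q where q: "reduce (starred_cycle c) = [q]" by (auto simp: length_Suc_conv)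
  with inv(1) obtain e where "q = Quantity e" by (cases q) auto
  with q inv(2) show ?thesis by (intro that[of e]) (auto simp: string_letters_starred_cycle)
qed

section \<open>The empty word as a right unit\<close>

lemma finite_injective_words: "finite (\<Gamma> n)"
proof (rule finite_subset)
  show "\<Gamma> n \<subseteq> {w. set w \<subseteq> {1..n} \<and> length w \<le> n}"
    using card_mono[of "{1..n}"] by (force simp: injective_words_def distinct_card[symmetric])
qed (simp add: finite_lists_length_le)

lemma concat_prod_outside:
  assumes "w \<notin> \<Gamma> n"
  shows "concat_prod n x y w = 0"
proof -
  have "x u * y v * (if set u \<inter> set v = {} then dirac (u @ v) w else 0) = 0"
    if "u \<in> \<Gamma> n" "v \<in> \<Gamma> n" for u v
    using that assms unfolding injective_words_def mem_Collect_eq dirac_def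
    by (metis distinct_append le_sup_iff mult_zero_right set_append)
  then show ?thesis unfolding concat_prod_def by (intro sum.neutral ballI)
qed

lemma concat_prod_unit_right:
  assumes "\<And>w. w \<notin> \<Gamma> n \<Longrightarrow> x w = 0"
  shows "concat_prod n x (dirac []) = x"
proof
  fix w
  have nil: "[] \<in> \<Gamma> n" by (simp add: injective_words_def)
  have "concat_prod n x (dirac []) w = (\<Sum>u\<in>\<Gamma> n. \<Sum>v\<in>\<Gamma> n. if v = [] then x u * dirac u w else 0)"
    unfolding concat_prod_def by (intro sum.cong refl) (auto simp: dirac_def)
  also have "\<dots> = (\<Sum>u\<in>\<Gamma> n. if u = w then x u else 0)"
    using nil by (intro sum.cong refl) (auto simp: finite_injective_words dirac_def)
  also have "\<dots> = x w"
    using assms by (simp add: finite_injective_words)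
  finally show "concat_prod n x (dirac []) w = x w" .
qed

text \<open>Whatever the factors are, a \<open>\<diamondop>\<close>-product is a function on \<open>\<Gamma> n\<close>, since its
  definition sums over words of \<open>\<Gamma> n\<close> with disjoint contents.\<close>

lemma diamond_unit_right: "concat_prod n (diamond n x y) (dirac []) = diamond n x y"
  by (rule concat_prod_unit_right) (simp add: diamond_def concat_prod_outside)

section \<open>Chains of permutations as products over their cycles\<close>

lemma is_standard_cycle_form_single:
  "is_standard_cycle_form \<tau> cs \<Longrightarrow> c \<in> set cs \<Longrightarrow> is_standard_cycle_form (cycle_of_list c) [c]"
  unfolding is_standard_cycle_form_def by (auto simp: distinct_concat_iff)

lemma perm_chain_eq_reduce:
  assumes "is_standard_cycle_form \<tau> cs"
  shows "perm_chain n \<tau> =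
    concat_prod_list n (concat (map (\<lambda>c. map (expr_value n \<circ> quantity) (reduce (starred_cycle c))) cs))"
proof -
  have "final_string \<tau> = concat (map reduce (map starred_cycle cs))"
    unfolding final_string_eq_reduce[OF assms]
    by (intro reduce_concat) (auto simp: stars_enclosed_starred_cycle)
  then show ?thesis by (simp add: perm_chain_def map_concat comp_def)
qed

text \<open>The cycle \<open>c\<close>, as a permutation, has the standard cycle form \<open>[c]\<close>, so its chain is computed
  from the same string; the only difference is the empty word in the product of a one-element list.\<close>

lemma reduce_starred_cycle_value:
  assumes "is_standard_cycle_form \<tau> cs" "c \<in> set cs"
  shows "map (expr_value n \<circ> quantity) (reduce (starred_cycle c)) = [perm_chain n (cycle_of_list c)]"
proof -
  have len: "length c \<ge> 2" using assms by (simp add: is_standard_cycle_form_def)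
  then have "c \<noteq> []" by auto
  then obtain e where e: "reduce (starred_cycle c) = [Quantity e]" "expr_letters e = c"
    by (rule reduce_starred_cycle)
  \<comment> \<open>A single letter \<open>a\<close> would not do: its value is not a function on \<open>\<Gamma> n\<close> if \<open>a\<close> exceeds \<open>n\<close>.\<close>
  obtain Q R where "e = Diamond Q R" using e(2) len by (cases e) auto
  then show ?thesis
    using e(1) perm_chain_eq_reduce[OF is_standard_cycle_form_single[OF assms], of n]
    by (simp add: concat_prod_list_def diamond_unit_right)
qed

theorem theorem7:
  fixes n :: nat and \<tau> :: "nat \<Rightarrow> nat" and cs :: "nat list list"
  assumes "\<tau> permutes {1..n}"
    and "\<tau> \<noteq> id"
    and "is_standard_cycle_form \<tau> cs"
  shows "perm_chain n \<tau> = concat_prod_list n (map (\<lambda>c. perm_chain n (cycle_of_list c)) cs)"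
proof -
  have "concat (map (\<lambda>c. map (expr_value n \<circ> quantity) (reduce (starred_cycle c))) cs)
      = concat (map (\<lambda>c. [perm_chain n (cycle_of_list c)]) cs)"
    using reduce_starred_cycle_value[OF assms(3)] by (intro arg_cong[of _ _ concat] map_cong refl)
  then show ?thesis unfolding perm_chain_eq_reduce[OF assms(3)] by (simp add: concat_map_singleton)
qed

end
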